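(* For any non-empty compact space $X$ and any integer $n\ge 1$, $$\mathrm{p\text{-}TC}(X\times\mathbb R^n)\ge \mathrm{TC}(X\times S^{n-1}).$$
   Context: All spaces are assumed metrizable. $I=[0,1]$ and $q\colon X^I\to X\times X$ is $q(\gamma)=(\gamma(0),\gamma(1))$. $\mathrm{TC}(X)$ is the (reduced) topological complexity: the least $n$ (or $\infty$) such that $X\times X$ is covered by $n+1$ open sets with continuous local sections of $q$. $\mathrm{p\text{-}TC}(X)$ (proper topological complexity) is the least $n$ (or $\infty$) such that $X\times X$ is covered by $n+1$ open sets $U_0,\dots,U_n$ with continuous local sections $\sigma_i\colon U_i\to X^I$ of $q$ such that: every compact $K\subseteq X$ is contained in a compact $L\subseteq X$ with $\operatorname{Im}\sigma_i(x,y)\subseteq X\setminus K$ for all $(x,y)\in U_i\cap\bigl((X\setminus L)\times (X\setminus L)\bigr)$. *)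

theory Defs
  imports "HOL-Analysis.Analysis"
begin

text \<open>
  The mapping space \<open>Y\<^sup>X\<close> with the compact-open topology, generated by the sets of all continuous
  maps that carry \<open>K\<close> into \<open>V\<close>. Maps are extensional functions, so that two maps that agree on
  the space \<open>X\<close> are the same point.
\<close>

definition compact_open_topology :: "'a topology \<Rightarrow> 'b topology \<Rightarrow> ('a \<Rightarrow> 'b) topology"
  where "compact_open_topology X Y =
    topology_generated_by
      {{f \<in> extensional (topspace X). continuous_map X Y f \<and> f ` K \<subseteq> V} | K V.
        compactin X K \<and> openin Y V}"

lemma topspace_compact_open_topology:
  "topspace (compact_open_topology X Y) = {f \<in> extensional (topspace X). continuous_map X Y f}"
proof -
  have "{f \<in> extensional (topspace X). continuous_map X Y f} =
      {f \<in> extensional (topspace X). continuous_map X Y f \<and> f ` {} \<subseteq> topspace Y}"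
    by simp
  moreover have "compactin X {}" "openin Y (topspace Y)"
    by simp_all
  ultimately show ?thesis
    unfolding compact_open_topology_def topology_generated_by_topspace by blast
qed

definition free_path_space :: "'a topology \<Rightarrow> (real \<Rightarrow> 'a) topology"
  where "free_path_space X = compact_open_topology (top_of_set {0..1}) X"

definition path_ends :: "(real \<Rightarrow> 'a) \<Rightarrow> 'a \<times> 'a"
  where "path_ends \<gamma> = (\<gamma> 0, \<gamma> 1)"

definition motion_planner ::
    "'a topology \<Rightarrow> ('a \<times> 'a) set \<Rightarrow> ('a \<times> 'a \<Rightarrow> real \<Rightarrow> 'a) \<Rightarrow> bool"
  where "motion_planner X U \<sigma> \<longleftrightarrow>
    openin (prod_topology X X) U \<and>
    continuous_map (subtopology (prod_topology X X) U) (free_path_space X) \<sigma> \<and>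
    (\<forall>p\<in>U. path_ends (\<sigma> p) = p)"

definition proper_motion_planner ::
    "'a topology \<Rightarrow> ('a \<times> 'a) set \<Rightarrow> ('a \<times> 'a \<Rightarrow> real \<Rightarrow> 'a) \<Rightarrow> bool"
  where "proper_motion_planner X U \<sigma> \<longleftrightarrow>
    motion_planner X U \<sigma> \<and>
    (\<forall>K. compactin X K \<longrightarrow>
      (\<exists>L. compactin X L \<and> K \<subseteq> L \<and>
        (\<forall>p \<in> U \<inter> ((topspace X - L) \<times> (topspace X - L)). \<sigma> p ` {0..1} \<subseteq> topspace X - K)))"

text \<open>
  In both invariants the infimum is taken in \<^typ>\<open>enat\<close>, where it is the least element of a
  nonempty set, and \<open>\<infinity>\<close> for the empty set.
\<close>

definition topological_complexity :: "'a topology \<Rightarrow> enat"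
  where "topological_complexity X =
    Inf {enat n | n. \<exists>U \<sigma>. (\<Union>i\<le>n. U i) = topspace X \<times> topspace X \<and>
      (\<forall>i\<le>n. motion_planner X (U i) (\<sigma> i))}"

definition proper_topological_complexity :: "'a topology \<Rightarrow> enat"
  where "proper_topological_complexity X =
    Inf {enat n | n. \<exists>U \<sigma>. (\<Union>i\<le>n. U i) = topspace X \<times> topspace X \<and>
      (\<forall>i\<le>n. proper_motion_planner X (U i) (\<sigma> i))}"

end

theory Submission
  imports Defs
begin

text \<open>
  The sphere bundle \<open>X \<times> S\<^bsup>n-1\<^esup>\<close>, scaled by a large radius, lies outside any prescribed compact
  subset of \<open>X \<times> \<real>\<^sup>n\<close>. Applying properness to the compact set \<open>X \<times> {0}\<close>, the planned paths
  between points of a large sphere miss the zero section, so they can be pushed radially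
  back to \<open>X \<times> S\<^bsup>n-1\<^esup>\<close>. One radius serves all of the finitely many planners, so the restricted
  domains still cover.
\<close>

section \<open>Postcomposition of paths and transport of motion planners\<close>

lemma continuous_map_restrict_compose:
  assumes "continuous_map X Y f" and "continuous_map (subtopology Y W) Z g"
    and "f ` topspace X \<subseteq> W"
  shows "continuous_map X Z (restrict (g \<circ> f) (topspace X))"
proof -
  have "continuous_map X (subtopology Y W) f"
    using assms(1,3) by (auto intro: continuous_map_into_subtopology)
  from continuous_map_compose[OF this assms(2)] show ?thesis
    by (rule continuous_map_eq) simp
qed

text \<open>A map \<open>g \<circ> f\<close> carries \<open>K\<close> into \<open>V\<close> exactly
  when \<open>f\<close> carries \<open>K\<close> into the \<open>g\<close>-preimage of
  \<open>V\<close>, so subbasic sets pull back to subbasic sets. As \<open>g\<close> lives only on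
  \<open>W\<close>, that preimage is open in \<open>Y\<close> because \<open>W\<close> is. The
  restriction keeps the values extensional, as the points of the mapping space must be.\<close>

lemma continuous_map_compact_open_postcompose:
  assumes "openin Y W" and g: "continuous_map (subtopology Y W) Z g"
    and s: "continuous_map T (compact_open_topology X Y) s"
    and sub: "\<And>t. t \<in> topspace T \<Longrightarrow> s t ` topspace X \<subseteq> W"
  shows "continuous_map T (compact_open_topology X Z) (\<lambda>t. restrict (g \<circ> s t) (topspace X))"
proof -
  let ?h = "\<lambda>t. restrict (g \<circ> s t) (topspace X)"
  have scont: "continuous_map X Y (s t)" if "t \<in> topspace T" for t
    using continuous_map_funspace[OF s] that by (auto simp: topspace_compact_open_topology)
  \<comment> \<open>Values of \<open>s\<close> are extensional and continuous anyway, so these two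
    clauses drop out of the preimage of a subbasic set.\<close>
  have sub_openin: "openin T {t \<in> topspace T. s t ` K \<subseteq> V}"
    if "compactin X K" "openin Y V" for K V
  proof -
    have "openin (compact_open_topology X Y)
        {f \<in> extensional (topspace X). continuous_map X Y f \<and> f ` K \<subseteq> V}"
      unfolding compact_open_topology_def using that
      by (intro topology_generated_by_Basis) blast
    from openin_continuous_map_preimage[OF s this]
    have "openin T {t \<in> topspace T. s t \<in> extensional (topspace X) \<and>
        continuous_map X Y (s t) \<and> s t ` K \<subseteq> V}"
      by simp
    moreover have "s t \<in> extensional (topspace X)" if "t \<in> topspace T" for t
      using continuous_map_funspace[OF s] that by (auto simp: topspace_compact_open_topology)
    ultimately show ?thesis
      using scont by (simp cong: conj_cong)
  qed
  have hcont: "continuous_map X Z (?h t)" if "t \<in> topspace T" for t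
    using continuous_map_restrict_compose[OF scont g sub] that by blast
  show ?thesis
    unfolding compact_open_topology_def
  proof (rule continuous_on_generated_topo)
    show "?h ` topspace T \<subseteq>
      \<Union>{{f \<in> extensional (topspace X). continuous_map X Z f \<and> f ` K \<subseteq> V} | K V.
        compactin X K \<and> openin Z V}"
      using hcont topspace_compact_open_topology[of X Z]
      unfolding compact_open_topology_def topology_generated_by_topspace by auto
  next
    fix A
    assume "A \<in> {{f \<in> extensional (topspace X). continuous_map X Z f \<and> f ` K \<subseteq> V} | K V.
        compactin X K \<and> openin Z V}"
    then obtain K V where A: "A = {f \<in> extensional (topspace X). continuous_map X Z f \<and> f ` K \<subseteq> V}"
      and K: "compactin X K" and V: "openin Z V"
      by blast
    \<comment> \<open>This is the \<open>g\<close>-preimage of \<open>V\<close>: the pair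
      \<open>K\<close>, \<open>V'\<close> replaces \<open>K\<close>, \<open>V\<close> when the
      subbasic set is pulled back.\<close>
    define V' where "V' = {y \<in> topspace (subtopology Y W). g y \<in> V}"
    have "openin (subtopology Y W) V'"
      unfolding V'_def by (rule openin_continuous_map_preimage[OF g V])
    then have V': "openin Y V'"
      using \<open>openin Y W\<close> openin_trans_full by blast
    have KX: "K \<subseteq> topspace X"
      using K by (rule compactin_subset_topspace)
    have "?h t ` K \<subseteq> V \<longleftrightarrow> s t ` K \<subseteq> V'" if "t \<in> topspace T" for t
    proof -
      have "s t x \<in> topspace Y \<inter> W" if "x \<in> K" for x
        using that \<open>t \<in> topspace T\<close> KX sub[of t] continuous_map_funspace[OF scont[of t]] by blast
      then show ?thesis
        using KX by (auto simp: V'_def image_subset_iff subset_iff)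
    qed
    then have "?h -` A \<inter> topspace T = {t \<in> topspace T. s t ` K \<subseteq> V'}"
      using hcont by (auto simp: A simp del: restrict_apply)
    then show "openin T (?h -` A \<inter> topspace T)"
      using sub_openin[OF K V'] by simp
  qed
qed

text \<open>Endpoints are sent into \<open>Y\<close> by \<open>e\<close>, joined there by
  \<open>\<sigma>\<close>, and the path is brought back by \<open>g\<close>. Since \<open>g\<close>
  undoes \<open>e\<close>, the new path has the required ends. It suffices that \<open>g\<close> is
  defined on an open set \<open>W\<close> containing those planned paths that start and end in the
  image of \<open>e\<close>.\<close>

lemma motion_planner_retract:
  assumes mp: "motion_planner Y U \<sigma>" and W: "openin Y W"
    and e: "continuous_map Z Y e" and g: "continuous_map (subtopology Y W) Z g"
    and ge: "\<And>z. z \<in> topspace Z \<Longrightarrow> g (e z) = z"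
    and sub: "\<And>p q. \<lbrakk>p \<in> topspace Z; q \<in> topspace Z; (e p, e q) \<in> U\<rbrakk>
      \<Longrightarrow> \<sigma> (e p, e q) ` {0..1} \<subseteq> W"
  shows "motion_planner Z {(p, q) \<in> topspace Z \<times> topspace Z. (e p, e q) \<in> U}
    (\<lambda>(p, q). restrict (g \<circ> \<sigma> (e p, e q)) {0..1})"
proof -
  let ?E = "\<lambda>(p, q). (e p, e q)"
  let ?V = "{(p, q) \<in> topspace Z \<times> topspace Z. (e p, e q) \<in> U}"
  have U: "openin (prod_topology Y Y) U"
    and \<sigma>: "continuous_map (subtopology (prod_topology Y Y) U)
      (compact_open_topology (top_of_set {0..1}) Y) \<sigma>"
    and ends: "\<And>p. p \<in> U \<Longrightarrow> \<sigma> p 0 = fst p \<and> \<sigma> p 1 = snd p"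
    using mp by (auto simp: motion_planner_def free_path_space_def path_ends_def)
  have E: "continuous_map (prod_topology Z Z) (prod_topology Y Y) ?E"
    using e by (simp add: continuous_map_prod_top)
  have "?V = {z \<in> topspace (prod_topology Z Z). ?E z \<in> U}"
    by auto
  then have V: "openin (prod_topology Z Z) ?V"
    using openin_continuous_map_preimage[OF E U] by simp
  have "continuous_map (subtopology (prod_topology Z Z) ?V) (subtopology (prod_topology Y Y) U) ?E"
    by (rule continuous_map_into_subtopology[OF continuous_map_from_subtopology[OF E]]) auto
  from continuous_map_compose[OF this \<sigma>]
  have "continuous_map (subtopology (prod_topology Z Z) ?V)
      (compact_open_topology (top_of_set {0..1}) Y) (\<sigma> \<circ> ?E)" .
  from continuous_map_compact_open_postcompose[OF W g this]
  have "continuous_map (subtopology (prod_topology Z Z) ?V) (free_path_space Z)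
      (\<lambda>t. restrict (g \<circ> (\<sigma> \<circ> ?E) t) {0..1})"
    using sub by (force simp: free_path_space_def)
  then have "continuous_map (subtopology (prod_topology Z Z) ?V) (free_path_space Z)
      (\<lambda>(p, q). restrict (g \<circ> \<sigma> (e p, e q)) {0..1})"
    by (simp add: case_prod_unfold comp_def)
  then show ?thesis
    using V ends ge by (auto simp: motion_planner_def path_ends_def)
qed

section \<open>Spheres and radial projection in Euclidean space\<close>

text \<open>The Euclidean norm on \<open>Euclidean_space (Suc k)\<close>; the index \<open>k\<close>
  is included in the sum, which matches the dimension convention of
  \<open>nsphere k\<close>.\<close>

definition radius :: "nat \<Rightarrow> (nat \<Rightarrow> real) \<Rightarrow> real"
  where "radius k x = sqrt (\<Sum>i\<le>k. (x i)\<^sup>2)"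

lemma topspace_nsphere_radius:
  "topspace (nsphere k) = {x \<in> topspace (Euclidean_space (Suc k)). radius k x = 1}"
  by (auto simp: nsphere_def radius_def)

lemma radius_scale: "0 \<le> r \<Longrightarrow> radius k (\<lambda>i. r * x i) = r * radius k x"
  by (simp add: radius_def power_mult_distrib real_sqrt_mult flip: sum_distrib_left)

lemma continuous_map_Euclidean_space_coordinate:
  "continuous_map (Euclidean_space n) euclideanreal (\<lambda>x. x i)"
  unfolding Euclidean_space_def
  by (blast intro: continuous_map_from_subtopology continuous_map_product_projection)

lemma continuous_map_radius: "continuous_map (Euclidean_space n) euclideanreal (radius k)"
  unfolding radius_def
  by (intro continuous_intros continuous_map_Euclidean_space_coordinate) auto

text \<open>A vanishing sum of squares kills the coordinates up to \<open>k\<close>; the later ones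
  vanish for every point of this space.\<close>

lemma radius_eq_0_iff:
  assumes "x \<in> topspace (Euclidean_space (Suc k))"
  shows "radius k x = 0 \<longleftrightarrow> x = (\<lambda>i. 0)"
proof -
  have "radius k x = 0 \<longleftrightarrow> (\<forall>i\<le>k. x i = 0)"
    by (auto simp: radius_def sum_nonneg_eq_0_iff)
  then show ?thesis
    using assms by (auto simp: topspace_Euclidean_space fun_eq_iff) (metis not_less_eq_eq)
qed

lemma continuous_map_radial_retraction:
  "continuous_map (subtopology (Euclidean_space (Suc k)) (- {\<lambda>i. 0})) (nsphere k)
    (\<lambda>x i. x i / radius k x)"
proof -
  let ?Y = "subtopology (Euclidean_space (Suc k)) (- {\<lambda>i. 0})"
  have nz: "radius k x \<noteq> 0" if "x \<in> topspace ?Y" for x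
    using that radius_eq_0_iff by auto
  have "continuous_map ?Y (powertop_real UNIV) (\<lambda>x i. x i / radius k x)"
    unfolding continuous_map_componentwise_UNIV
    using nz by (intro allI continuous_map_real_divide continuous_map_from_subtopology
      continuous_map_Euclidean_space_coordinate continuous_map_radius)
  moreover have "radius k (\<lambda>i. x i / radius k x) = 1" if "x \<in> topspace ?Y" for x
  proof -
    have "radius k x \<ge> 0"
      by (simp add: radius_def sum_nonneg)
    then show ?thesis
      \<comment> \<open>Normalising is scaling by the nonnegative factor
        \<open>inverse (radius k x)\<close>, so homogeneity of the norm applies.\<close>
      using nz[OF that] radius_scale[of "inverse (radius k x)" k x]
      by (simp add: field_simps)
  qed
  ultimately show ?thesis
    unfolding nsphere_def Euclidean_space_def
    by (auto simp: continuous_map_in_subtopology radius_def)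
qed

lemma continuous_map_sphere_scale:
  "continuous_map (nsphere k) (Euclidean_space (Suc k)) (\<lambda>x i. r * x i)"
  unfolding Euclidean_space_def continuous_map_in_subtopology continuous_map_componentwise_UNIV
  using topspace_nsphere_radius[of k]
  by (auto intro!: continuous_map_real_mult_left continuous_map_nsphere_projection
      simp: topspace_Euclidean_space)

text \<open>For positive \<open>r\<close> it embeds the product with the unit sphere as the product
  with the sphere of radius \<open>r\<close>.\<close>

definition sphere_scale :: "real \<Rightarrow> 'a \<times> (nat \<Rightarrow> real) \<Rightarrow> 'a \<times> (nat \<Rightarrow> real)"
  where "sphere_scale r z = (fst z, \<lambda>i. r * snd z i)"

lemma continuous_map_sphere_scale_prod:
  "continuous_map (prod_topology X (nsphere k)) (prod_topology X (Euclidean_space (Suc k)))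
    (sphere_scale r)"
  using continuous_map_prod_top[of X "nsphere k" X _ id "\<lambda>x i. r * x i"]
    continuous_map_sphere_scale[of k r]
  by (simp add: case_prod_unfold sphere_scale_def[abs_def])

section \<open>Proper planners on large spheres and the comparison of the invariants\<close>

text \<open>The norm is bounded on the compact set \<open>L\<close> that properness yields for the
  zero section, so every larger sphere lies outside \<open>L\<close>. The form "for all large
  \<open>r\<close>" lets finitely many planners share one radius.\<close>

lemma eventually_planner_avoids_zero_section:
  assumes "compact_space X"
    and pmp: "proper_motion_planner (prod_topology X (Euclidean_space (Suc k))) U \<sigma>"
  shows "\<forall>\<^sub>F r in at_top. \<forall>p \<in> topspace (prod_topology X (nsphere k)).
    \<forall>q \<in> topspace (prod_topology X (nsphere k)).
      (sphere_scale r p, sphere_scale r q) \<in> U \<longrightarrow>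
      \<sigma> (sphere_scale r p, sphere_scale r q) ` {0..1} \<subseteq>
        topspace X \<times> (topspace (Euclidean_space (Suc k)) - {\<lambda>i. 0})"
proof -
  let ?E = "Euclidean_space (Suc k)"
  let ?Y = "prod_topology X ?E" and ?Z = "prod_topology X (nsphere k)"
  \<comment> \<open>Compactness of \<open>X\<close> enters here: it makes the zero section an
    admissible \<open>K\<close> in the properness condition.\<close>
  have "compactin ?Y (topspace X \<times> {\<lambda>i. 0})"
    using \<open>compact_space X\<close>
    by (auto simp: compactin_Times compact_space_def topspace_Euclidean_space)
  then obtain L where L: "compactin ?Y L"
    and avoid: "\<And>p. p \<in> U \<inter> ((topspace ?Y - L) \<times> (topspace ?Y - L)) \<Longrightarrow>
      \<sigma> p ` {0..1} \<subseteq> topspace ?Y - topspace X \<times> {\<lambda>i. 0}"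
    using pmp unfolding proper_motion_planner_def by meson
  have "continuous_map ?Y euclideanreal (radius k \<circ> snd)"
    using continuous_map_compose[OF continuous_map_snd continuous_map_radius] .
  then have "compact ((radius k \<circ> snd) ` L)"
    using image_compactin[OF L] by fastforce
  then obtain B where B: "\<And>z. z \<in> L \<Longrightarrow> radius k (snd z) \<le> B"
    using compact_imp_bounded bounded_imp_bdd_above unfolding bdd_above_def by fastforce
  \<comment> \<open>With \<open>0 \<le> r\<close> the scaled sphere has norm exactly
    \<open>r\<close>; with \<open>B < r\<close> it misses \<open>L\<close>.\<close>
  have "\<forall>\<^sub>F r in at_top. 0 \<le> r \<and> B < r"
    by (intro eventually_conj eventually_ge_at_top eventually_gt_at_top)
  then show ?thesis
  proof (rule eventually_mono, intro ballI impI)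
    fix r p q
    assume r: "0 \<le> r \<and> B < r" and p: "p \<in> topspace ?Z" and q: "q \<in> topspace ?Z"
      and U: "(sphere_scale r p, sphere_scale r q) \<in> U"
    have out: "sphere_scale r z \<in> topspace ?Y - L" if "z \<in> topspace ?Z" for z
    proof -
      have "radius k (snd (sphere_scale r z)) = r"
        using that r by (auto simp: sphere_scale_def radius_scale topspace_nsphere_radius)
      then have "sphere_scale r z \<notin> L"
        using B[of "sphere_scale r z"] r by auto
      moreover have "sphere_scale r z \<in> topspace ?Y"
        using continuous_map_funspace[OF continuous_map_sphere_scale_prod] that by blast
      ultimately show ?thesis
        by blast
    qed
    then show "\<sigma> (sphere_scale r p, sphere_scale r q) ` {0..1} \<subseteq>
        topspace X \<times> (topspace ?E - {\<lambda>i. 0})"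
      using avoid[of "(sphere_scale r p, sphere_scale r q)"] U out[OF p] out[OF q] by auto
  qed
qed

lemma topological_complexity_sphere_le:
  assumes "compact_space X"
    and cover: "(\<Union>i\<le>m. U i) =
      topspace (prod_topology X (Euclidean_space (Suc k))) \<times>
      topspace (prod_topology X (Euclidean_space (Suc k)))"
    and pmp: "\<And>i. i \<le> m \<Longrightarrow>
      proper_motion_planner (prod_topology X (Euclidean_space (Suc k))) (U i) (\<sigma> i)"
  shows "topological_complexity (prod_topology X (nsphere k)) \<le> enat m"
proof -
  let ?E = "Euclidean_space (Suc k)"
  let ?Y = "prod_topology X ?E" and ?Z = "prod_topology X (nsphere k)"
  let ?W = "topspace X \<times> (topspace ?E - {\<lambda>i. 0})"
  have "\<forall>\<^sub>F r in at_top. \<forall>i\<in>{..m}. \<forall>p \<in> topspace ?Z. \<forall>q \<in> topspace ?Z.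
      (sphere_scale r p, sphere_scale r q) \<in> U i \<longrightarrow>
      \<sigma> i (sphere_scale r p, sphere_scale r q) ` {0..1} \<subseteq> ?W"
    using eventually_planner_avoids_zero_section[OF \<open>compact_space X\<close> pmp]
    by (intro eventually_ball_finite) auto
  \<comment> \<open>Strict positivity is added so that dividing by the norm \<open>r\<close> undoes
    the scaling.\<close>
  then have "\<forall>\<^sub>F r in at_top. 0 < r \<and> (\<forall>i\<in>{..m}. \<forall>p \<in> topspace ?Z. \<forall>q \<in> topspace ?Z.
      (sphere_scale r p, sphere_scale r q) \<in> U i \<longrightarrow>
      \<sigma> i (sphere_scale r p, sphere_scale r q) ` {0..1} \<subseteq> ?W)"
    by (intro eventually_conj eventually_gt_at_top)
  then obtain r where r: "0 < r"
    and avoid: "\<And>i p q. \<lbrakk>i \<le> m; p \<in> topspace ?Z; q \<in> topspace ?Z;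
      (sphere_scale r p, sphere_scale r q) \<in> U i\<rbrakk> \<Longrightarrow>
      \<sigma> i (sphere_scale r p, sphere_scale r q) ` {0..1} \<subseteq> ?W"
    by (auto dest!: eventually_happens' [OF trivial_limit_at_top_linorder])
  define g :: "'a \<times> (nat \<Rightarrow> real) \<Rightarrow> 'a \<times> (nat \<Rightarrow> real)"
    where "g = (\<lambda>(x, v). (x, \<lambda>i. v i / radius k v))"
  \<comment> \<open>The complement of the zero section is itself a product, so \<open>g\<close> is
    continuous as the identity on \<open>X\<close> times the radial projection.\<close>
  have Y_W: "subtopology ?Y ?W = prod_topology X (subtopology ?E (- {\<lambda>i. 0}))"
    by (metis Diff_eq subtopology_Times subtopology_restrict subtopology_topspace)
  have g: "continuous_map (subtopology ?Y ?W) ?Z g"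
    using continuous_map_radial_retraction[of k]
    by (simp add: Y_W g_def
        continuous_map_prod_top[where f = "\<lambda>x. x" and g = "\<lambda>v i. v i / radius k v"])
  have "closedin ?E {\<lambda>i. 0}"
    by (simp add: closedin_Euclidean_space_iff topspace_Euclidean_space)
  then have W: "openin ?Y ?W"
    by (simp add: openin_prod_Times_iff openin_diff)
  have ge: "g (sphere_scale r z) = z" if "z \<in> topspace ?Z" for z
    using that r
    by (auto simp: g_def sphere_scale_def radius_scale topspace_nsphere_radius)
  let ?U = "\<lambda>i. {(p, q) \<in> topspace ?Z \<times> topspace ?Z. (sphere_scale r p, sphere_scale r q) \<in> U i}"
  let ?\<sigma> = "\<lambda>i (p, q). restrict (g \<circ> \<sigma> i (sphere_scale r p, sphere_scale r q)) {0..1}"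
  have mp: "motion_planner ?Z (?U i) (?\<sigma> i)" if "i \<le> m" for i
    using pmp[OF that]
    by (intro motion_planner_retract[OF _ W continuous_map_sphere_scale_prod g ge] avoid that)
      (auto simp: proper_motion_planner_def)
  \<comment> \<open>The new domains are preimages of the \<open>U i\<close> under one common map,
    because \<open>r\<close> does not depend on \<open>i\<close>; hence they inherit the covering
    property.\<close>
  have covered: "\<exists>i\<le>m. (sphere_scale r p, sphere_scale r q) \<in> U i"
    if "p \<in> topspace ?Z" "q \<in> topspace ?Z" for p q
  proof -
    have "(sphere_scale r p, sphere_scale r q) \<in> topspace ?Y \<times> topspace ?Y"
      using continuous_map_funspace[OF continuous_map_sphere_scale_prod] that by blast
    then show ?thesis
      unfolding cover[symmetric] by blast
  qed
  have "(\<Union>i\<le>m. ?U i) = topspace ?Z \<times> topspace ?Z"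
  proof (intro equalityI subsetI)
    fix z
    assume "z \<in> topspace ?Z \<times> topspace ?Z"
    then obtain p q where z: "z = (p, q)" and p: "p \<in> topspace ?Z" and q: "q \<in> topspace ?Z"
      by (rule SigmaE)
    from covered[OF p q] show "z \<in> (\<Union>i\<le>m. ?U i)"
      unfolding z using p q by blast
  qed blast
  then have "\<exists>U \<sigma>. (\<Union>i\<le>m. U i) = topspace ?Z \<times> topspace ?Z \<and>
      (\<forall>i\<le>m. motion_planner ?Z (U i) (\<sigma> i))"
    by (intro exI[of _ ?U] exI[of _ ?\<sigma>] conjI allI impI mp)
  then show ?thesis
    unfolding topological_complexity_def by (intro Inf_lower CollectI exI[of _ m] conjI refl)
qed

theorem theorem3p9:
  fixes X :: "'a topology" and n :: nat
  assumes "metrizable_space X"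
    and "compact_space X"
    and "topspace X \<noteq> {}"
    and "n \<ge> 1"
  shows "proper_topological_complexity (prod_topology X (Euclidean_space n))
    \<ge> topological_complexity (prod_topology X (nsphere (n - 1)))"
proof -
  \<comment> \<open>With \<open>n = Suc k\<close> the sphere of dimension \<open>n - 1\<close>
    becomes \<open>nsphere k\<close>.\<close>
  obtain k where n: "n = Suc k"
    using \<open>n \<ge> 1\<close> by (cases n) auto
  show ?thesis
    unfolding n proper_topological_complexity_def diff_Suc_1
  \<comment> \<open>It is enough to bound the left-hand invariant by each admissible
    \<open>m\<close>; if there is none, the infimum is \<open>\<infinity>\<close> and nothing
    remains to prove.\<close>
  proof (rule Inf_greatest, clarify)
    fix m :: nat and U \<sigma>
    let ?Y = "prod_topology X (Euclidean_space (Suc k))"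
    assume cover: "(\<Union>i\<le>m. U i) = topspace ?Y \<times> topspace ?Y"
      and pmp: "\<forall>i\<le>m. proper_motion_planner ?Y (U i) (\<sigma> i)"
    show "topological_complexity (prod_topology X (nsphere k)) \<le> enat m"
      using pmp
      by (intro topological_complexity_sphere_le[OF \<open>compact_space X\<close> cover, where \<sigma> = \<sigma>]) simp
  qed
qed

end
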